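(* Let $a,z_0,\dots,z_n$ be given points in $\mathbb{D}$ and put $\tau_j=[a,z_j]$ for $j=0,1,\dots,n$. (i) Suppose that $f\in\mathrm{H}(\mathbb{D})$ is not a Blaschke product of degree at most $n$. Let $f_j(z)=f_j(z;z_{j-1},\dots,z_0)$ and $\gamma_j=f_j(z_j)$ for $j=0,1,\dots,n$. Define Möbius transformations $A_j$, $j=0,1,\dots,n$ (constant maps when $\tau_j=0$), by $$A_j(x)=\frac{\tau_jx+\gamma_j}{1+\overline{\gamma_j}\tau_jx}.$$ Then $f(a)\in(A_0\circ\cdots\circ A_n)(\overline{\mathbb{D}})$. If furthermore $f$ is not a Blaschke product of degree $n+1$, then $f(a)\in(A_0\circ\cdots\circ A_n)(\mathbb{D})$. (ii) Conversely, suppose that points $\gamma_0,\gamma_1,\dots,\gamma_n\in\mathbb{D}$ are given. Let $A_j(x)=\dfrac{\tau_jx+\gamma_j}{1+\overline{\gamma_j}\tau_jx}$ for $j=0,\dots,n$, and choose an arbitrary point $b\in(A_0\circ\cdots\circ A_n)(\overline{\mathbb{D}})$. Then there exists a function $f\in\mathrm{H}(\mathbb{D})$ with $f(a)=b$ such that $\gamma_j=f_j(z_j;z_{j-1},\dots,z_0)$ for $j=0,1,\dots,n$.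
   Context: $\mathbb{D}=\{z\in\mathbb{C}:|z|<1\}$, and $\mathrm{H}(\mathbb{D})$ is the set of holomorphic functions $f$ on $\mathbb{D}$ with $|f|\le 1$. For $z,w\in\mathbb{D}$ put $[z,w]=\dfrac{z-w}{1-\overline{w}z}$, and put $[z,z]=0$ for $z\in\partial\mathbb{D}$. A (finite) Blaschke product of degree $n$ is a function $e^{i\theta}\prod_{j=1}^n[z,a_j]$ with $\theta\in\mathbb{R}$ and $a_1,\dots,a_n\in\mathbb{D}$; those of degree $0$ are the unimodular constants. For $f\in\mathrm{H}(\mathbb{D})$ and $z_0\in\mathbb{D}$ define $\Delta_{z_0}f\in\mathrm{H}(\mathbb{D})$ by $\Delta_{z_0}f(z)=\dfrac{[f(z),f(z_0)]}{[z,z_0]}$ for $z\neq z_0$ and $\Delta_{z_0}f(z_0)=\dfrac{(1-|z_0|^2)f'(z_0)}{1-|f(z_0)|^2}$ (if $f$ is a unimodular constant, $\Delta_{z_0}f\equiv 0$). It is known from the Schwarz–Pick lemma that $\Delta_{z_0}$ maps $\mathrm{H}(\mathbb{D})$ into itself. For points $z_0,z_1,\dots\in\mathbb{D}$ (not necessarily distinct) define $f_j(z;z_{j-1},\dots,z_0)=(\Delta_{z_{j-1}}\circ\cdots\circ\Delta_{z_0})f(z)$, with $f_0(z)=f(z)$ for $j=0$. *)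

theory Defs
  imports "HOL-Complex_Analysis.Complex_Analysis"
begin

text \<open>
  The unit disc is \<open>ball 0 1\<close>. Functions on the disc are total functions on
  \<^typ>\<open>complex\<close> of which only the values on \<open>ball 0 1\<close> matter.
\<close>

definition schur_class :: "(complex \<Rightarrow> complex) set" where
  "schur_class = {f. f holomorphic_on ball 0 1 \<and> (\<forall>z\<in>ball 0 1. norm (f z) \<le> 1)}"

text \<open>
  The bracket \<open>[z,w]\<close>. The convention \<open>[z,z] = 0\<close> on the unit circle needs no separate
  clause, the numerator being \<open>0\<close> (and \<open>x / 0 = 0\<close>).
\<close>

definition bracket :: "complex \<Rightarrow> complex \<Rightarrow> complex" where
  "bracket z w = (z - w) / (1 - cnj w * z)"

lemma bracket_self [simp]: "bracket z z = 0"
  by (simp add: bracket_def)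

lemma bracket_eq_Moebius_function: "bracket z w = Moebius_function 0 w z"
  by (simp add: bracket_def Moebius_function_def)

definition blaschke_product :: "nat \<Rightarrow> (complex \<Rightarrow> complex) \<Rightarrow> bool" where
  "blaschke_product n f \<longleftrightarrow>
     (\<exists>(\<theta>::real) (a::nat \<Rightarrow> complex). (\<forall>j\<in>{1..n}. a j \<in> ball 0 1) \<and>
        (\<forall>z\<in>ball 0 1. f z = exp (\<i> * of_real \<theta>) * (\<Prod>j=1..n. bracket z (a j))))"

text \<open>
  The hyperbolic difference quotient \<open>\<Delta>\<^bsub>w\<^esub> f\<close>. If \<open>f\<close> is a unimodular constant on the disc,
  both branches give \<open>0\<close>, as required; see the lemma below.
\<close>

definition hyp_diff :: "complex \<Rightarrow> (complex \<Rightarrow> complex) \<Rightarrow> complex \<Rightarrow> complex" where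
  "hyp_diff w f z =
     (if z = w then of_real (1 - (norm w)\<^sup>2) * deriv f w / of_real (1 - (norm (f w))\<^sup>2)
      else bracket (f z) (f w) / bracket z w)"

lemma hyp_diff_unimodular_const:
  assumes "\<And>z. z \<in> ball 0 1 \<Longrightarrow> f z = c" "norm c = 1" "w \<in> ball 0 1" "z \<in> ball 0 1"
  shows "hyp_diff w f z = 0"
  using assms by (simp add: hyp_diff_def)

text \<open>
  \<open>hyp_iter zs f j\<close> is the function \<open>z \<mapsto> f\<^sub>j(z; z\<^bsub>j-1\<^esub>, \<dots>, z\<^sub>0)\<close> with \<open>z\<^sub>i = zs i\<close>.
\<close>

primrec hyp_iter :: "(nat \<Rightarrow> complex) \<Rightarrow> (complex \<Rightarrow> complex) \<Rightarrow> nat \<Rightarrow> complex \<Rightarrow> complex" where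
  "hyp_iter zs f 0 = f"
| "hyp_iter zs f (Suc j) = hyp_diff (zs j) (hyp_iter zs f j)"

definition moebius_step :: "complex \<Rightarrow> complex \<Rightarrow> complex \<Rightarrow> complex" where
  "moebius_step \<tau> \<gamma> x = (\<tau> * x + \<gamma>) / (1 + cnj \<gamma> * \<tau> * x)"

text \<open>\<open>comp_upto A n\<close> is \<open>A 0 \<circ> A 1 \<circ> \<dots> \<circ> A n\<close>.\<close>

primrec comp_upto :: "(nat \<Rightarrow> 'a \<Rightarrow> 'a) \<Rightarrow> nat \<Rightarrow> 'a \<Rightarrow> 'a" where
  "comp_upto A 0 = A 0"
| "comp_upto A (Suc n) = comp_upto A n \<circ> A (Suc n)"

end

theory Submission
  imports Defs "HOL-Computational_Algebra.Fundamental_Theorem_Algebra"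
begin

text \<open>
  The theorem is the Schur algorithm read at the single point \<open>a\<close>.  If \<open>norm (f w) < 1\<close>, the
  definition of the hyperbolic difference quotient \<open>g = \<Delta>\<^bsub>w\<^esub> f\<close> says that
  \<open>[f(z), f(w)] = [z, w] g(z)\<close>.  The inverse of \<open>x \<mapsto> [x, \<gamma>]\<close> is \<open>x \<mapsto> [x, -\<gamma>]\<close>, so this can be
  solved for \<open>f(z)\<close>, and at \<open>z = a\<close> it becomes \<open>f(a) = A(g(a))\<close> with the Moebius step \<open>A\<close> whose
  parameters are \<open>\<tau> = [a, w]\<close> and \<open>\<gamma> = f(w)\<close> (\<open>eq_moebius_step_hyp_diff\<close>).

  For part (i) this identity is iterated: \<open>f(a) = (A\<^sub>0 \<circ> \<dots> \<circ> A\<^sub>n)(f\<^bsub>n+1\<^esub>(a))\<close>.  The step is possible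
  as long as \<open>norm (f\<^sub>j(z\<^sub>j)) < 1\<close>, that is, by the maximum principle, as long as \<open>f\<^sub>j\<close> is not a
  unimodular constant.  The hypothesis on Blaschke products guarantees this because
  \<open>\<Delta>\<close> lowers the degree by at most one: if \<open>\<Delta>\<^bsub>w\<^esub> f\<close> is a Blaschke product of degree \<open>m\<close>, then \<open>f\<close>
  is the image under a disc automorphism of the Blaschke product \<open>[z, w] \<Delta>\<^bsub>w\<^esub> f(z)\<close> of degree
  \<open>m + 1\<close>, and automorphisms of the disc preserve the degree
  (\<open>blaschke_product_bracket_comp\<close>, the only part that requires real work).  That \<open>f\<^bsub>n+1\<^esub>\<close> is
  bounded by \<open>1\<close> is the Schwarz--Pick lemma.  It takes a value of modulus \<open>1\<close> in the disc only if it
  is a unimodular constant, and then \<open>f\<close> is a Blaschke product of degree \<open>n + 1\<close>.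

  For part (ii) the algorithm is run backwards.  If \<open>b = (A\<^sub>0 \<circ> \<dots> \<circ> A\<^sub>n)(x)\<close>, start from the constant
  function \<open>x\<close> and, for \<open>j = n, \<dots>, 0\<close>, pass from \<open>g\<close> to the function with value \<open>\<gamma>\<^sub>j\<close> at
  \<open>z\<^sub>j\<close> whose difference quotient there is \<open>g\<close> (\<open>schur_lift\<close>, \<open>hyp_diff_schur_lift\<close>).
\<close>

section \<open>Disc automorphisms\<close>

lemma one_minus_cnj_mult_nonzero:
  assumes "norm w < 1" "norm z \<le> 1"
  shows "1 - cnj w * z \<noteq> 0"
proof -
  have "norm (cnj w * z) < 1"
    using assms mult_left_le[of "norm z" "norm w"] by (simp add: norm_mult)
  then show ?thesis by auto
qed

text \<open>
  This identity decides on which side of the unit circle \<open>[z,w]\<close> lies: for \<open>norm w < 1\<close> the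
  sign of the difference is that of \<open>1 - norm z\<close>.
\<close>

lemma norm_bracket_identity:
  "(norm (1 - cnj w * z))\<^sup>2 - (norm (z - w))\<^sup>2 = (1 - (norm w)\<^sup>2) * (1 - (norm z)\<^sup>2)"
  by (simp add: cmod_power2) (simp add: algebra_simps power2_eq_square)

lemma norm_bracket_le:
  assumes "norm w < 1" "norm z \<le> 1"
  shows "norm (bracket z w) \<le> 1"
proof -
  have "0 \<le> (1 - (norm w)\<^sup>2) * (1 - (norm z)\<^sup>2)"
    using assms by (intro mult_nonneg_nonneg) (auto simp: power_le_one)
  then have "(norm (z - w))\<^sup>2 \<le> (norm (1 - cnj w * z))\<^sup>2"
    using norm_bracket_identity[of w z] by linarith
  then have "norm (z - w) \<le> norm (1 - cnj w * z)"
    by (rule power2_le_imp_le) simp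
  then show ?thesis
    using one_minus_cnj_mult_nonzero[OF assms] by (simp add: bracket_def norm_divide)
qed

lemma norm_bracket_less:
  assumes "norm w < 1" "norm z < 1"
  shows "norm (bracket z w) < 1"
  using Moebius_function_norm_lt_1[OF assms] by (simp add: bracket_eq_Moebius_function)

lemma bracket_holomorphic [holomorphic_intros]:
  assumes "norm w < 1" "f holomorphic_on S" "\<And>z. z \<in> S \<Longrightarrow> norm (f z) \<le> 1"
  shows "(\<lambda>z. bracket (f z) w) holomorphic_on S"
  unfolding bracket_def
  by (intro holomorphic_intros assms one_minus_cnj_mult_nonzero)

lemma bracket_uminus_cancel:
  assumes "norm w < 1" "norm z \<le> 1"
  shows "bracket (bracket z w) (- w) = z"
proof -
  have nz: "1 - cnj w * z \<noteq> 0" "1 - cnj w * w \<noteq> 0"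
    using one_minus_cnj_mult_nonzero assms by simp_all
  have "bracket (bracket z w) (- w) = ((z - w) / (1 - cnj w * z) + w) / (1 + cnj w * ((z - w) / (1 - cnj w * z)))"
    by (simp add: bracket_def)
  also have "(z - w) / (1 - cnj w * z) + w = z * (1 - cnj w * w) / (1 - cnj w * z)"
    using nz by (simp add: field_simps)
  also have "1 + cnj w * ((z - w) / (1 - cnj w * z)) = (1 - cnj w * w) / (1 - cnj w * z)"
    using nz by (simp add: field_simps)
  finally show ?thesis using nz by simp
qed

lemma bracket_eq_0_iff:
  assumes "norm w < 1" "norm z \<le> 1"
  shows "bracket z w = 0 \<longleftrightarrow> z = w"
  using one_minus_cnj_mult_nonzero[OF assms] by (simp add: bracket_def)

text \<open>
  A Moebius step is multiplication by \<open>\<tau>\<close> followed by a disc automorphism; so every property of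
  the maps \<open>A\<^sub>j\<close> reduces to one of the bracket.
\<close>

lemma moebius_step_eq_bracket: "moebius_step \<tau> \<gamma> x = bracket (\<tau> * x) (- \<gamma>)"
  by (simp add: moebius_step_def bracket_def mult.assoc)

section \<open>Blaschke products\<close>

text \<open>
  The multiset of zeros is the form in which a polynomial factorization over the complex
  numbers arrives; it also avoids reindexing when factors are added.
\<close>

lemma blaschke_product_iff_zeros:
  "blaschke_product n f \<longleftrightarrow>
     (\<exists>u A. norm u = 1 \<and> size A = n \<and> (\<forall>a\<in>#A. norm a < 1) \<and>
        (\<forall>z\<in>ball 0 1. f z = u * (\<Prod>a\<in>#A. bracket z a)))" (is "?L \<longleftrightarrow> ?R")
proof
  assume ?L
  then obtain \<theta> :: real and a :: "nat \<Rightarrow> complex" where a: "\<forall>j\<in>{1..n}. a j \<in> ball 0 1"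
    and f: "\<forall>z\<in>ball 0 1. f z = exp (\<i> * of_real \<theta>) * (\<Prod>j=1..n. bracket z (a j))"
    unfolding blaschke_product_def by blast
  show ?R
    by (rule exI[of _ "exp (\<i> * of_real \<theta>)"], rule exI[of _ "image_mset a (mset_set {1..n})"])
       (use a f in \<open>auto simp: prod_unfold_prod_mset image_mset.compositionality o_def\<close>)
next
  assume ?R
  then obtain u A where u: "norm u = 1" and A: "size A = n" "\<forall>a\<in>#A. norm a < 1"
    and f: "\<forall>z\<in>ball 0 1. f z = u * (\<Prod>a\<in>#A. bracket z a)" by blast
  obtain xs where xs: "mset xs = A" using ex_mset by blast
  have len: "length xs = n" using A(1) xs by auto
  have "(\<Prod>a\<in>#A. bracket z a) = (\<Prod>j=1..n. bracket z (xs ! (j - 1)))" for z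
  proof -
    have "(\<Prod>a\<in>#A. bracket z a) = prod_list (map (bracket z) xs)"
      by (simp flip: xs prod_mset_prod_list)
    also have "\<dots> = (\<Prod>i<n. bracket z (xs ! i))"
      by (simp add: prod.list_conv_set_nth len atLeast0LessThan)
    also have "\<dots> = (\<Prod>j=1..n. bracket z (xs ! (j - 1)))"
      by (rule prod.reindex_bij_witness[of _ "\<lambda>j. j - 1" Suc]) auto
    finally show ?thesis .
  qed
  moreover have "u = exp (\<i> * of_real (Arg u))"
    using u Arg_eq[of u] by (cases "u = 0") auto
  moreover have "\<forall>j\<in>{1..n}. xs ! (j - 1) \<in> ball 0 1"
  proof
    fix j assume "j \<in> {1..n}"
    then have "xs ! (j - 1) \<in> set xs" using len by (intro nth_mem) auto
    then show "xs ! (j - 1) \<in> ball 0 1" using A(2) by (simp flip: xs)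
  qed
  ultimately show ?L
    unfolding blaschke_product_def using f by metis
qed

lemma blaschke_product_mult_bracket:
  assumes "blaschke_product n g" "norm w < 1"
  shows "blaschke_product (Suc n) (\<lambda>z. bracket z w * g z)"
proof -
  obtain u A where "norm u = 1" "size A = n" "\<forall>a\<in>#A. norm a < 1"
    and g: "\<forall>z\<in>ball 0 1. g z = u * (\<Prod>a\<in>#A. bracket z a)"
    using assms(1) unfolding blaschke_product_iff_zeros by blast
  then show ?thesis
    unfolding blaschke_product_iff_zeros using assms(2)
    by (intro exI[of _ u] exI[of _ "add_mset w A"]) auto
qed

lemma blaschke_product_cong:
  assumes "blaschke_product n f" "\<And>z. z \<in> ball 0 1 \<Longrightarrow> g z = f z"
  shows "blaschke_product n g"
  using assms unfolding blaschke_product_def by metis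

lemma poly_prod_mset_image: "poly (\<Prod>a\<in>#A. p a) z = (\<Prod>a\<in>#A. poly (p a) z)"
  for p :: "'b \<Rightarrow> 'a::comm_ring_1 poly"
  by (induction A) auto

text \<open>
  Some of the \<open>c a\<close> may vanish, so the coefficient at \<open>size A\<close> need not be the leading
  coefficient.
\<close>

lemma prod_mset_linear_top:
  fixes b c :: "'a \<Rightarrow> 'b::comm_ring_1"
  shows "degree (\<Prod>a\<in>#A. [:b a, c a:]) \<le> size A"
    and "coeff (\<Prod>a\<in>#A. [:b a, c a:]) (size A) = (\<Prod>a\<in>#A. c a)"
proof (induction A)
  case (add x A)
  let ?p = "\<Prod>a\<in>#A. [:b a, c a:]"
  have "degree ([:b x, c x:] * ?p) \<le> degree [:b x, c x:] + degree ?p"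
    by (rule degree_mult_le)
  also have "\<dots> \<le> 1 + size A" using add(1) by (intro add_mono) auto
  finally show "degree (\<Prod>a\<in>#add_mset x A. [:b a, c a:]) \<le> size (add_mset x A)" by simp
  have "coeff ?p (Suc (size A)) = 0" using add(1) by (intro coeff_eq_0) simp
  then show "coeff (\<Prod>a\<in>#add_mset x A. [:b a, c a:]) (size (add_mset x A)) = (\<Prod>a\<in>#add_mset x A. c a)"
    using add(2) by simp
qed auto

text \<open>
  Up to the factor \<open>z^n\<close>, conjugation combined with the reflection \<open>z \<mapsto> 1 / cnj z\<close> in the unit
  circle exchanges the numerator and the denominator of a Blaschke product.
\<close>

lemma reversed_prod_mset:
  fixes z :: complex
  assumes "z \<noteq> 0"
  shows "z ^ size A * cnj (\<Prod>a\<in>#A. 1 / cnj z - a) = (\<Prod>a\<in>#A. 1 - cnj a * z)"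
    and "z ^ size A * cnj (\<Prod>a\<in>#A. 1 - cnj a * (1 / cnj z)) = (\<Prod>a\<in>#A. z - a)"
proof (induction A)
  case (add x A)
  { case 1
    have "z ^ size (add_mset x A) * cnj (\<Prod>a\<in>#add_mset x A. 1 / cnj z - a)
        = (z * cnj (1 / cnj z - x)) * (z ^ size A * cnj (\<Prod>a\<in>#A. 1 / cnj z - a))"
      by (simp add: mult_ac)
    also have "z * cnj (1 / cnj z - x) = 1 - cnj x * z" using assms by (simp add: field_simps)
    also note add(1)
    finally show ?case by simp }
  { case 2
    have "z ^ size (add_mset x A) * cnj (\<Prod>a\<in>#add_mset x A. 1 - cnj a * (1 / cnj z))
        = (z * cnj (1 - cnj x * (1 / cnj z))) * (z ^ size A * cnj (\<Prod>a\<in>#A. 1 - cnj a * (1 / cnj z)))"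
      by (simp only: image_mset_add_mset prod_mset.add_mset size_add_mset power_Suc complex_cnj_mult mult_ac)
    also have "z * cnj (1 - cnj x * (1 / cnj z)) = z - x" using assms by (simp add: field_simps)
    also note add(2)
    finally show ?case by simp }
qed auto

lemma prod_mset_bracket: "(\<Prod>a\<in>#A. bracket z a) = (\<Prod>a\<in>#A. z - a) / (\<Prod>a\<in>#A. 1 - cnj a * z)"
  by (induction A) (auto simp: bracket_def)

lemma norm_prod_mset_mono:
  fixes f g :: "'a \<Rightarrow> complex"
  assumes "\<And>a. a \<in># A \<Longrightarrow> norm (f a) \<le> norm (g a)"
  shows "norm (\<Prod>a\<in>#A. f a) \<le> norm (\<Prod>a\<in>#A. g a)"
  using assms by (induction A) (auto simp: norm_mult intro!: mult_mono)

text \<open>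
  Write \<open>f = u P / Q\<close> with \<open>P = \<Prod>(z - a)\<close> and \<open>Q = \<Prod>(1 - cnj a z)\<close>, so that
  \<open>[f, \<gamma>] = N / D\<close> with \<open>N = u P - \<gamma> Q\<close> and \<open>D = Q - cnj \<gamma> u P\<close>.  The polynomial \<open>N\<close> has degree
  exactly \<open>n\<close>, and all its roots lie in the disc, since \<open>norm (Q z) \<le> norm (P z)\<close> outside the disc
  and therefore \<open>u P\<close> dominates \<open>\<gamma> Q\<close> there.  Reflection in the unit circle exchanges \<open>P\<close> and \<open>Q\<close>
  and hence turns \<open>N\<close> into a unimodular multiple of \<open>D\<close>; so \<open>D\<close> is, up to a constant, the
  denominator \<open>\<Prod>(1 - cnj b z)\<close> that belongs to the roots \<open>b\<close> of \<open>N\<close>.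
\<close>

lemma blaschke_product_bracket_comp:
  assumes "blaschke_product n f" and \<gamma>: "norm \<gamma> < 1"
  shows "blaschke_product n (\<lambda>z. bracket (f z) \<gamma>)"
proof -
  obtain u A where u: "norm u = 1" and n: "size A = n" and A: "\<And>a. a \<in># A \<Longrightarrow> norm a < 1"
    and f: "\<And>z. z \<in> ball 0 1 \<Longrightarrow> f z = u * (\<Prod>a\<in>#A. bracket z a)"
    using assms(1) unfolding blaschke_product_iff_zeros by blast
  define P where "P z = (\<Prod>a\<in>#A. z - a)" for z
  define Q where "Q z = (\<Prod>a\<in>#A. 1 - cnj a * z)" for z
  define v where "v = (\<Prod>a\<in>#A. - cnj a)"
  define c where "c = u - \<gamma> * v"
  define N where "N = smult u (\<Prod>a\<in>#A. [:- a, 1:]) - smult \<gamma> (\<Prod>a\<in>#A. [:1, - cnj a:])"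
  have N: "poly N z = u * P z - \<gamma> * Q z" for z
    by (simp add: N_def P_def Q_def poly_prod_mset_image mult.commute)
  have uu: "u * cnj u = 1" using u by (simp add: complex_norm_square[symmetric])
  have "norm v \<le> norm (\<Prod>a\<in>#A. 1::complex)"
    unfolding v_def using A by (intro norm_prod_mset_mono) (simp add: less_imp_le)
  then have "norm (\<gamma> * v) < 1"
    using \<gamma> mult_left_le[of "norm v" "norm \<gamma>"] by (simp add: norm_mult)
  then have c0: "c \<noteq> 0" unfolding c_def using u by auto
  \<comment> \<open>The degree does not drop, because \<open>c\<close> is nonzero.\<close>
  have "coeff N n = c"
    using prod_mset_linear_top(2)[of uminus "\<lambda>_. 1" A] prod_mset_linear_top(2)[of "\<lambda>_. 1" "\<lambda>a. - cnj a" A]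
    by (simp add: N_def c_def v_def n)
  moreover have "degree N \<le> n"
    unfolding N_def using prod_mset_linear_top(1)[of uminus "\<lambda>_. 1" A] prod_mset_linear_top(1)[of "\<lambda>_. 1" "\<lambda>a. - cnj a" A]
    by (intro degree_diff_le order.trans[OF degree_smult_le]) (simp_all add: n)
  ultimately have deg: "degree N = n" and lead: "lead_coeff N = c"
    using c0 le_degree[of N n] by auto
  then have "N \<noteq> 0" using c0 by auto
  then obtain B where B: "size B = n" "N = smult c (\<Prod>b\<in>#B. [:- b, 1:])"
    using alg_closed_imp_factorization[of N] deg lead by auto
  have NB: "poly N z = c * (\<Prod>b\<in>#B. z - b)" for z
    by (simp add: B(2) poly_prod_mset_image)
  have roots: "norm b < 1" if "b \<in># B" for b
  proof (rule ccontr)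
    assume "\<not> norm b < 1"
    then have b: "1 \<le> norm b" by simp
    have "norm (Q b) \<le> norm (P b)"
      unfolding P_def Q_def
    proof (rule norm_prod_mset_mono)
      fix a assume "a \<in># A"
      then have "(1 - (norm a)\<^sup>2) * (1 - (norm b)\<^sup>2) \<le> 0"
        using b A[of a] by (intro mult_nonneg_nonpos) (auto simp: power_le_one)
      then have "(norm (1 - cnj a * b))\<^sup>2 \<le> (norm (b - a))\<^sup>2"
        using norm_bracket_identity[of a b] by linarith
      then show "norm (1 - cnj a * b) \<le> norm (b - a)"
        by (rule power2_le_imp_le) simp
    qed
    then have "norm (\<gamma> * Q b) \<le> norm \<gamma> * norm (P b)"
      by (simp add: norm_mult mult_left_mono)
    also have "\<dots> < 1 * norm (P b)"
    proof (rule mult_strict_right_mono[OF \<gamma>])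
      have "P b \<noteq> 0" using b A by (fastforce simp: P_def)
      then show "0 < norm (P b)" by simp
    qed
    also have "\<dots> = norm (u * P b)" using u by (simp add: norm_mult)
    finally have "norm (\<gamma> * Q b) < norm (u * P b)" .
    then have "poly N b \<noteq> 0" unfolding N by auto
    moreover have "poly N b = 0" using that by (auto simp: NB)
    ultimately show False by simp
  qed
  \<comment> \<open>The reflection argument gives this for nonzero \<open>z\<close>; at \<open>0\<close> it is the formula for the
    leading coefficient \<open>c\<close> of \<open>N\<close>.\<close>
  have D: "Q z - cnj \<gamma> * (u * P z) = u * cnj c * (\<Prod>b\<in>#B. 1 - cnj b * z)" for z
  proof (cases "z = 0")
    case True
    have "cnj v = (\<Prod>a\<in>#A. - a)" unfolding v_def by (induction A) auto
    with True show ?thesis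
      using uu by (simp add: P_def Q_def c_def algebra_simps)
  next
    case False
    have "u * cnj c * (\<Prod>b\<in>#B. 1 - cnj b * z) = u * (z ^ n * cnj (poly N (1 / cnj z)))"
      using reversed_prod_mset(1)[OF False, of B] by (simp add: NB B(1) mult_ac)
    also have "\<dots> = u * cnj u * (z ^ n * cnj (P (1 / cnj z))) - u * cnj \<gamma> * (z ^ n * cnj (Q (1 / cnj z)))"
      by (simp add: N algebra_simps)
    also have "\<dots> = Q z - u * cnj \<gamma> * P z"
      using reversed_prod_mset[OF False, of A] by (simp add: P_def Q_def n uu)
    finally show ?thesis by (simp add: mult_ac)
  qed
  have "bracket (f z) \<gamma> = c / (u * cnj c) * (\<Prod>b\<in>#B. bracket z b)" if z: "z \<in> ball 0 1" for z
  proof -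
    have Q0: "Q z \<noteq> 0"
      using z A one_minus_cnj_mult_nonzero[of _ z] by (force simp: Q_def)
    have "f z = u * P z / Q z" using f[OF z] by (simp add: prod_mset_bracket P_def Q_def)
    then have "bracket (f z) \<gamma> = (u * P z / Q z - \<gamma>) / (1 - cnj \<gamma> * (u * P z / Q z))"
      by (simp add: bracket_def)
    also have "\<dots> = ((u * P z - \<gamma> * Q z) / Q z) / ((Q z - cnj \<gamma> * (u * P z)) / Q z)"
      using Q0 by (simp add: diff_divide_distrib)
    also have "\<dots> = (u * P z - \<gamma> * Q z) / (Q z - cnj \<gamma> * (u * P z))"
      using Q0 by simp
    finally show ?thesis
      unfolding D N[symmetric] NB prod_mset_bracket by simp
  qed
  moreover have "norm (c / (u * cnj c)) = 1" using u c0 by (simp add: norm_divide norm_mult)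
  ultimately show ?thesis
    unfolding blaschke_product_iff_zeros using B(1) roots by blast
qed

section \<open>The hyperbolic difference quotient\<close>

lemma schur_class_norm_less:
  assumes f: "f \<in> schur_class" and "\<not> blaschke_product 0 f" and w: "norm w < 1"
  shows "norm (f w) < 1"
proof (rule ccontr)
  assume "\<not> norm (f w) < 1"
  then have fw: "norm (f w) = 1" using f w by (force simp: schur_class_def)
  have "f constant_on ball 0 1"
    using f w fw by (intro maximum_modulus_principle[where U = "ball 0 1" and \<xi> = w])
      (auto simp: schur_class_def)
  then have "\<forall>z\<in>ball 0 1. f z = f w"
    using w by (metis constant_on_def dist_0_norm mem_ball)
  then have "blaschke_product 0 f"
    unfolding blaschke_product_iff_zeros using fw by (intro exI[of _ "f w"]) auto
  with assms(2) show False by simp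
qed

text \<open>
  Up to a nonvanishing holomorphic factor the quotient is the ordinary difference quotient of
  \<open>f\<close> at \<open>w\<close>, whose singularity is removable; the value prescribed at \<open>w\<close> is the one that this
  factorization gives.
\<close>

lemma hyp_diff_holomorphic:
  assumes f: "f \<in> schur_class" and w: "norm w < 1" and fw: "norm (f w) < 1"
  shows "hyp_diff w f holomorphic_on ball 0 1"
proof -
  define q where "q z = (if z = w then deriv f w else (f z - f w) / (z - w))" for z
  have fb: "norm (f z) \<le> 1" if "norm z < 1" for z using f that by (auto simp: schur_class_def)
  have "hyp_diff w f = (\<lambda>z. q z * ((1 - cnj w * z) / (1 - cnj (f w) * f z)))"
    by (rule ext) (simp add: hyp_diff_def q_def bracket_def complex_norm_square[symmetric]
        mult.commute[of "cnj w" w] mult.commute[of "cnj (f w)" "f w"])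
  moreover have "(\<lambda>z. q z * ((1 - cnj w * z) / (1 - cnj (f w) * f z))) holomorphic_on ball 0 1"
  proof (intro holomorphic_intros)
    show "q holomorphic_on ball 0 1"
      unfolding q_def using f by (intro pole_lemma_open) (auto simp: schur_class_def)
    show "f holomorphic_on ball 0 1" using f by (simp add: schur_class_def)
  qed (use one_minus_cnj_mult_nonzero fw fb in simp)
  ultimately show ?thesis by (simp only:)
qed

text \<open>
  Conjugating \<open>f\<close> by the automorphisms that send \<open>w\<close> and \<open>f w\<close> to \<open>0\<close> reduces this to the Schwarz
  lemma.
\<close>

lemma schwarz_pick:
  assumes f: "f \<in> schur_class" and nb: "\<not> blaschke_product 0 f"
    and w: "norm w < 1" and z: "norm z < 1"
  shows "norm (bracket (f z) (f w)) \<le> norm (bracket z w)"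
proof -
  define g where "g \<zeta> = bracket (f (bracket \<zeta> (- w))) (f w)" for \<zeta>
  have inner: "norm (bracket \<zeta> (- w)) < 1" if "norm \<zeta> < 1" for \<zeta>
    using that w by (intro norm_bracket_less) auto
  have "norm (g (bracket z w)) \<le> norm (bracket z w)"
  proof (rule Schwarz_Lemma(1))
    have "(\<lambda>\<zeta>. f (bracket \<zeta> (- w))) holomorphic_on ball 0 1"
      using holomorphic_on_compose_gen[of "\<lambda>\<zeta>. bracket \<zeta> (- w)" "ball 0 1" f "ball 0 1"] f w inner
      by (force simp: schur_class_def o_def intro!: holomorphic_intros)
    then show "g holomorphic_on ball 0 1"
      unfolding g_def using schur_class_norm_less[OF f nb] w inner
      by (intro bracket_holomorphic) (auto intro: less_imp_le)
    show "g 0 = 0" by (simp add: g_def bracket_def)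
    show "norm (g \<zeta>) < 1" if "norm \<zeta> < 1" for \<zeta>
      unfolding g_def using schur_class_norm_less[OF f nb] inner[OF that] w
      by (intro norm_bracket_less) auto
    show "norm (bracket z w) < 1" using w z by (intro norm_bracket_less)
  qed
  then show ?thesis using bracket_uminus_cancel[of w z] w z by (simp add: g_def)
qed

text \<open>
  Away from \<open>w\<close> the bound is the Schwarz--Pick inequality; it passes to \<open>w\<close> by continuity.
\<close>

lemma hyp_diff_in_schur_class:
  assumes f: "f \<in> schur_class" and nb: "\<not> blaschke_product 0 f" and w: "norm w < 1"
  shows "hyp_diff w f \<in> schur_class"
proof -
  have hol: "hyp_diff w f holomorphic_on ball 0 1"
    using hyp_diff_holomorphic[OF f w] schur_class_norm_less[OF f nb w] by simp
  have off: "norm (hyp_diff w f z) \<le> 1" if "norm z < 1" "z \<noteq> w" for z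
    using schwarz_pick[OF f nb w that(1)] that bracket_eq_0_iff[of w z] w
    by (simp add: hyp_diff_def norm_divide)
  have "norm (hyp_diff w f w) \<le> 1"
  proof (rule Lim_norm_ubound)
    have "isCont (hyp_diff w f) w"
      using holomorphic_on_imp_continuous_on[OF hol] w
      by (simp add: continuous_on_eq_continuous_at)
    then show "(hyp_diff w f \<longlongrightarrow> hyp_diff w f w) (at w)" by (simp add: isCont_def)
    show "eventually (\<lambda>z. norm (hyp_diff w f z) \<le> 1) (at w)"
      by (rule eventually_mono[OF eventually_at_in_open[of "ball 0 1" w]]) (use off w in auto)
  qed simp
  with off hol show ?thesis by (fastforce simp: schur_class_def)
qed

text \<open>
  The identity that drives the whole argument: one step of the Schur algorithm, undone.
\<close>

lemma eq_moebius_step_hyp_diff: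
  assumes f: "f \<in> schur_class" and w: "norm w < 1" and z: "norm z < 1" and fw: "norm (f w) < 1"
  shows "f z = moebius_step (bracket z w) (f w) (hyp_diff w f z)"
proof (cases "z = w")
  case True
  then show ?thesis by (simp add: moebius_step_def)
next
  case False
  then have "bracket z w * hyp_diff w f z = bracket (f z) (f w)"
    using bracket_eq_0_iff[of w z] w z by (simp add: hyp_diff_def)
  moreover have "norm (f z) \<le> 1" using f z by (simp add: schur_class_def)
  ultimately show ?thesis
    using fw by (simp add: moebius_step_eq_bracket bracket_uminus_cancel)
qed

text \<open>
  By the previous identity, \<open>f\<close> is a disc automorphism applied to \<open>[z,w] \<Delta>\<^bsub>w\<^esub> f(z)\<close>, which has
  one zero more than \<open>\<Delta>\<^bsub>w\<^esub> f\<close>.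
\<close>

lemma blaschke_product_of_hyp_diff:
  assumes "blaschke_product m (hyp_diff w f)"
    and f: "f \<in> schur_class" and w: "norm w < 1" and fw: "norm (f w) < 1"
  shows "blaschke_product (Suc m) f"
proof (rule blaschke_product_cong)
  show "blaschke_product (Suc m) (\<lambda>z. bracket (bracket z w * hyp_diff w f z) (- f w))"
    using assms by (intro blaschke_product_bracket_comp blaschke_product_mult_bracket) auto
  show "f z = bracket (bracket z w * hyp_diff w f z) (- f w)" if "z \<in> ball 0 1" for z
    using eq_moebius_step_hyp_diff[OF f w _ fw] that by (simp add: moebius_step_eq_bracket)
qed

text \<open>
  Needed because the functions of the backward construction are known only up to equality on
  the disc; the derivative in the definition still sees a full neighbourhood of \<open>w\<close>.
\<close>

lemma hyp_diff_cong:
  assumes eq: "\<And>z. z \<in> ball 0 1 \<Longrightarrow> f z = g z" and "w \<in> ball 0 1" "z \<in> ball 0 1"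
  shows "hyp_diff w f z = hyp_diff w g z"
proof -
  have "eventually (\<lambda>z. f z = g z) (nhds w)"
    by (rule eventually_mono[OF eventually_nhds_in_open[of "ball 0 1"]]) (use assms in auto)
  then have "deriv f w = deriv g w" by (rule deriv_cong_ev) simp
  with assms show ?thesis by (simp add: hyp_diff_def)
qed

text \<open>
  The step inverse to \<open>\<Delta>\<^bsub>w\<^esub>\<close>: the relation \<open>[f(z), \<gamma>] = [z, w] g(z)\<close> solved for \<open>f(z)\<close>.
\<close>

definition schur_lift :: "complex \<Rightarrow> complex \<Rightarrow> (complex \<Rightarrow> complex) \<Rightarrow> complex \<Rightarrow> complex" where
  "schur_lift w \<gamma> g z = moebius_step (bracket z w) \<gamma> (g z)"

lemma schur_lift_at [simp]: "schur_lift w \<gamma> g w = \<gamma>"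
  by (simp add: schur_lift_def moebius_step_def)

lemma norm_bracket_mult_le:
  assumes "g \<in> schur_class" "norm w < 1" "norm z < 1"
  shows "norm (bracket z w * g z) \<le> 1"
  using assms norm_bracket_le[of w z] by (auto simp: schur_class_def norm_mult intro!: mult_le_one)

lemma schur_lift_in_schur_class:
  assumes g: "g \<in> schur_class" and w: "norm w < 1" and \<gamma>: "norm \<gamma> < 1"
  shows "schur_lift w \<gamma> g \<in> schur_class"
proof -
  have "(\<lambda>z. bracket (bracket z w * g z) (- \<gamma>)) holomorphic_on ball 0 1"
    using g w \<gamma> norm_bracket_mult_le[OF g w]
    by (intro holomorphic_intros) (auto simp: schur_class_def)
  moreover have "norm (bracket (bracket z w * g z) (- \<gamma>)) \<le> 1" if "norm z < 1" for z
    using norm_bracket_mult_le[OF g w that] \<gamma> by (intro norm_bracket_le) auto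
  ultimately show ?thesis
    by (simp add: schur_class_def schur_lift_def[abs_def] moebius_step_eq_bracket)
qed

text \<open>
  Off \<open>w\<close> the automorphisms cancel.  At \<open>w\<close>, where the difference quotient is a derivative,
  the two sides agree because both are continuous.
\<close>

lemma hyp_diff_schur_lift:
  assumes g: "g \<in> schur_class" and w: "norm w < 1" and \<gamma>: "norm \<gamma> < 1" and z: "z \<in> ball 0 1"
  shows "hyp_diff w (schur_lift w \<gamma> g) z = g z"
proof -
  let ?h = "hyp_diff w (schur_lift w \<gamma> g)"
  have off: "?h z = g z" if "norm z < 1" "z \<noteq> w" for z
  proof -
    have "bracket (schur_lift w \<gamma> g z) \<gamma> = bracket z w * g z"
      using bracket_uminus_cancel[of "- \<gamma>" "bracket z w * g z"] norm_bracket_mult_le[OF g w that(1)] \<gamma>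
      by (simp add: schur_lift_def moebius_step_eq_bracket)
    then show ?thesis
      using that bracket_eq_0_iff[of w z] w by (simp add: hyp_diff_def)
  qed
  have "?h w = g w"
  proof (rule tendsto_unique[of "at w"])
    have "?h holomorphic_on ball 0 1" "g holomorphic_on ball 0 1"
      using hyp_diff_holomorphic[OF schur_lift_in_schur_class[OF g w \<gamma>] w] \<gamma> g
      by (auto simp: schur_class_def)
    then have "isCont ?h w" "isCont g w"
      using w by (auto dest!: holomorphic_on_imp_continuous_on simp: continuous_on_eq_continuous_at)
    then have h_lim: "(?h \<longlongrightarrow> ?h w) (at w)" and g_lim: "(g \<longlongrightarrow> g w) (at w)"
      by (simp_all add: isCont_def)
    show "(?h \<longlongrightarrow> ?h w) (at w)" by (rule h_lim)
    have "eventually (\<lambda>z. g z = ?h z) (at w)"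
      by (rule eventually_mono[OF eventually_at_in_open[of "ball 0 1" w]]) (use off w in auto)
    with g_lim show "(?h \<longlongrightarrow> g w) (at w)"
      by (rule Lim_transform_eventually)
  qed simp
  with off z show ?thesis by (cases "z = w") auto
qed

section \<open>The Schur algorithm\<close>

text \<open>
  Both claims have to be carried through the induction together: the step from \<open>f\<^sub>k\<close> to \<open>f\<^bsub>k+1\<^esub>\<close>
  needs that \<open>f\<^sub>k\<close> is not a unimodular constant, and the degree count excludes this, since
  otherwise \<open>f\<close> would be a Blaschke product of degree \<open>k\<close>.
\<close>

lemma hyp_iter_in_schur_class:
  assumes f: "f \<in> schur_class" and "\<And>j. j < k \<Longrightarrow> norm (z j) < 1"
    and "\<And>m. m < k \<Longrightarrow> \<not> blaschke_product m f"
  shows "hyp_iter z f k \<in> schur_class \<and>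
         (\<forall>m. blaschke_product m (hyp_iter z f k) \<longrightarrow> blaschke_product (m + k) f)"
  using assms(2,3)
proof (induction k)
  case (Suc k)
  then have IH: "hyp_iter z f k \<in> schur_class"
    "\<And>m. blaschke_product m (hyp_iter z f k) \<Longrightarrow> blaschke_product (m + k) f" by auto
  have nb: "\<not> blaschke_product 0 (hyp_iter z f k)" using IH(2)[of 0] Suc.prems(2)[of k] by auto
  have zk: "norm (z k) < 1" using Suc.prems(1) by simp
  show ?case
    using hyp_diff_in_schur_class[OF IH(1) nb zk] IH(2)
      blaschke_product_of_hyp_diff[OF _ IH(1) zk schur_class_norm_less[OF IH(1) nb zk]]
    by fastforce
qed (use f in auto)

lemma comp_upto_hyp_iter:
  assumes f: "f \<in> schur_class" and a: "norm a < 1"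
    and "\<And>j. j \<le> n \<Longrightarrow> norm (z j) < 1"
    and "\<And>m. m \<le> n \<Longrightarrow> \<not> blaschke_product m f"
    and "\<And>j. j \<le> n \<Longrightarrow> A j = moebius_step (bracket a (z j)) (hyp_iter z f j (z j))"
  shows "f a = comp_upto A n (hyp_iter z f (Suc n) a)"
proof -
  have step: "hyp_iter z f k a = A k (hyp_iter z f (Suc k) a)" if "k \<le> n" for k
  proof -
    have "hyp_iter z f k \<in> schur_class \<and>
         (\<forall>m. blaschke_product m (hyp_iter z f k) \<longrightarrow> blaschke_product (m + k) f)"
      by (rule hyp_iter_in_schur_class) (use assms that in auto)
    moreover from this have "\<not> blaschke_product 0 (hyp_iter z f k)"
      using assms(4)[of k] that by fastforce
    ultimately show ?thesis
      using eq_moebius_step_hyp_diff[of "hyp_iter z f k" "z k" a] schur_class_norm_less assms(3,5) that a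
      by simp
  qed
  have "f a = comp_upto A k (hyp_iter z f (Suc k) a)" if "k \<le> n" for k
    using that
  proof (induction k)
    case 0
    then show ?case using step[of 0] by simp
  next
    case (Suc k)
    then show ?case using step[of "Suc k"] by simp
  qed
  then show ?thesis by simp
qed

text \<open>
  The composition \<open>A\<^sub>0 \<circ> \<dots> \<circ> A\<^sub>n\<close> is extended at its inner end, so the induction has to leave
  the final function \<open>g\<close> free: the last lift is absorbed into \<open>g\<close>, and the claim that the
  algorithm returns \<open>g\<close> on the disc is what allows one more step afterwards.
\<close>

lemma schur_interpolation:
  assumes "g \<in> schur_class" and "a \<in> ball 0 1"
    and "\<And>j. j \<le> n \<Longrightarrow> norm (z j) < 1" and "\<And>j. j \<le> n \<Longrightarrow> norm (\<gamma> j) < 1"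
    and "\<And>j. j \<le> n \<Longrightarrow> A j = moebius_step (bracket a (z j)) (\<gamma> j)"
  shows "\<exists>f\<in>schur_class. (\<forall>j\<le>n. hyp_iter z f j (z j) = \<gamma> j) \<and>
           (\<forall>x\<in>ball 0 1. hyp_iter z f (Suc n) x = g x) \<and> f a = comp_upto A n (g a)"
  using assms
proof (induction n arbitrary: g)
  case 0
  then show ?case
    using schur_lift_in_schur_class[of g "z 0" "\<gamma> 0"] hyp_diff_schur_lift[of g "z 0" "\<gamma> 0"]
    by (intro bexI[of _ "schur_lift (z 0) (\<gamma> 0) g"]) (auto simp: schur_lift_def[of _ _ _ a])
next
  case (Suc n)
  define g' where "g' = schur_lift (z (Suc n)) (\<gamma> (Suc n)) g"
  have z: "norm (z (Suc n)) < 1" and \<gamma>: "norm (\<gamma> (Suc n)) < 1" using Suc.prems by auto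
  have "g' \<in> schur_class"
    unfolding g'_def using Suc.prems(1) z \<gamma> by (rule schur_lift_in_schur_class)
  from Suc.IH[OF this] obtain f where f: "f \<in> schur_class" "\<forall>j\<le>n. hyp_iter z f j (z j) = \<gamma> j"
      "\<forall>x\<in>ball 0 1. hyp_iter z f (Suc n) x = g' x" "f a = comp_upto A n (g' a)"
    using Suc.prems by auto
  have "hyp_iter z f j (z j) = \<gamma> j" if "j \<le> Suc n" for j
  proof (cases "j = Suc n")
    case True
    have "hyp_iter z f (Suc n) (z (Suc n)) = g' (z (Suc n))" using f(3) z by (metis dist_0_norm mem_ball)
    with True show ?thesis by (simp add: g'_def del: hyp_iter.simps)
  next
    case False
    then show ?thesis using f(2) that by simp
  qed
  moreover have "hyp_iter z f (Suc (Suc n)) x = g x" if "x \<in> ball 0 1" for x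
  proof -
    have "hyp_iter z f (Suc (Suc n)) x = hyp_diff (z (Suc n)) g' x"
      unfolding hyp_iter.simps(2)[of z f "Suc n"] using f(3) z that by (intro hyp_diff_cong) auto
    then show ?thesis unfolding g'_def using hyp_diff_schur_lift[OF Suc.prems(1) z \<gamma> that] by simp
  qed
  moreover have "f a = comp_upto A (Suc n) (g a)"
    using f(4) Suc.prems(5)[of "Suc n"] by (simp add: g'_def schur_lift_def)
  ultimately show ?case using f(1) by blast
qed

theorem theorem2p4:
  fixes a :: complex and z :: "nat \<Rightarrow> complex" and n :: nat and \<tau> :: "nat \<Rightarrow> complex"
  assumes "a \<in> ball 0 1"
    and "\<And>j. j \<le> n \<Longrightarrow> z j \<in> ball 0 1"
    and "\<And>j. j \<le> n \<Longrightarrow> \<tau> j = bracket a (z j)"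
  shows "(\<forall>f \<in> schur_class. \<forall>(\<gamma> :: nat \<Rightarrow> complex) (A :: nat \<Rightarrow> complex \<Rightarrow> complex).
            (\<forall>m\<le>n. \<not> blaschke_product m f) \<longrightarrow>
            (\<forall>j\<le>n. \<gamma> j = hyp_iter z f j (z j)) \<longrightarrow>
            (\<forall>j\<le>n. A j = moebius_step (\<tau> j) (\<gamma> j)) \<longrightarrow>
              f a \<in> comp_upto A n ` cball 0 1 \<and>
              (\<not> blaschke_product (n + 1) f \<longrightarrow> f a \<in> comp_upto A n ` ball 0 1))
       \<and> (\<forall>(\<gamma> :: nat \<Rightarrow> complex) (A :: nat \<Rightarrow> complex \<Rightarrow> complex) (b :: complex).
            (\<forall>j\<le>n. \<gamma> j \<in> ball 0 1) \<longrightarrow>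
            (\<forall>j\<le>n. A j = moebius_step (\<tau> j) (\<gamma> j)) \<longrightarrow>
            b \<in> comp_upto A n ` cball 0 1 \<longrightarrow>
              (\<exists>f \<in> schur_class. f a = b \<and> (\<forall>j\<le>n. \<gamma> j = hyp_iter z f j (z j))))"
proof -
  have a: "norm a < 1" using assms(1) by simp
  have z: "norm (z j) < 1" if "j \<le> n" for j using assms(2)[OF that] by simp
  show ?thesis
  proof (intro conjI ballI allI impI)
    fix f and \<gamma> :: "nat \<Rightarrow> complex" and A :: "nat \<Rightarrow> complex \<Rightarrow> complex"
    assume f: "f \<in> schur_class" and nb: "\<forall>m\<le>n. \<not> blaschke_product m f"
      and \<gamma>: "\<forall>j\<le>n. \<gamma> j = hyp_iter z f j (z j)"
      and A: "\<forall>j\<le>n. A j = moebius_step (\<tau> j) (\<gamma> j)"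
    have fa: "f a = comp_upto A n (hyp_iter z f (Suc n) a)"
      by (rule comp_upto_hyp_iter) (use f a z nb \<gamma> A assms(3) in auto)
    have last: "hyp_iter z f (Suc n) \<in> schur_class \<and>
        (\<forall>m. blaschke_product m (hyp_iter z f (Suc n)) \<longrightarrow> blaschke_product (m + Suc n) f)"
      by (rule hyp_iter_in_schur_class) (use f z nb in auto)
    then have "hyp_iter z f (Suc n) a \<in> cball 0 1"
      using assms(1) by (auto simp: schur_class_def)
    with fa show "f a \<in> comp_upto A n ` cball 0 1" by blast
    assume "\<not> blaschke_product (n + 1) f"
    with last have "\<not> blaschke_product 0 (hyp_iter z f (Suc n))" by fastforce
    then have "hyp_iter z f (Suc n) a \<in> ball 0 1"
      using last a schur_class_norm_less[of "hyp_iter z f (Suc n)" a] by auto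
    with fa show "f a \<in> comp_upto A n ` ball 0 1" by blast
  next
    fix \<gamma> :: "nat \<Rightarrow> complex" and A :: "nat \<Rightarrow> complex \<Rightarrow> complex" and b :: complex
    assume \<gamma>: "\<forall>j\<le>n. \<gamma> j \<in> ball 0 1" and A: "\<forall>j\<le>n. A j = moebius_step (\<tau> j) (\<gamma> j)"
      and "b \<in> comp_upto A n ` cball 0 1"
    then obtain x where x: "x \<in> cball 0 1" "b = comp_upto A n x" by blast
    have "(\<lambda>_. x) \<in> schur_class" using x by (simp add: schur_class_def)
    from schur_interpolation[OF this assms(1), of n z \<gamma> A]
    show "\<exists>f\<in>schur_class. f a = b \<and> (\<forall>j\<le>n. \<gamma> j = hyp_iter z f j (z j))"
      using z \<gamma> A assms(3) x(2) by auto
  qed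
qed

end
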